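(* Let $p\ge3$ and $n\ge1$ be integers. Let $\tau>0$; for each $i=1,\ldots,n$ let $(\alpha^1_i,\beta^1_i,\zeta^1_i)>0$ (each component positive) and $0\ne(\alpha^2_i,\beta^2_i,\zeta^2_i)\ge0$ (each component nonnegative, not all zero); and let $\zeta^s_i>0$ for $s=3,\ldots,p$ and $i=1,\ldots,n$. Then there exists a constant $\bar\varepsilon>0$ such that for any $\alpha^s_i,\beta^s_i\in[0,\bar\varepsilon)$, $s=3,\ldots,p$, $i=1,\ldots,n$, the closed loop dynamics matrix $A_{\mathrm c}(\boldsymbol\alpha,\boldsymbol\beta,\boldsymbol\zeta,\tau)\in\mathbb R^{2n\times 2n}$ defined in the context is Schur stable, i.e., its spectral radius is strictly less than $1$.
   Context: Let $p,n\ge 1$ be integers and $\tau>0$. For $s=1,\ldots,p$ let $Q_{z,s}=\mathrm{diag}(\alpha^s_1,\ldots,\alpha^s_n)$, $Q_{z',s}=\mathrm{diag}(\beta^s_1,\ldots,\beta^s_n)$, $Q_{w,s}=\mathrm{diag}(\zeta^s_1,\ldots,\zeta^s_n)$, and let $\boldsymbol\alpha=(\alpha^s_i)_{s,i}$, $\boldsymbol\beta=(\beta^s_i)_{s,i}$, $\boldsymbol\zeta=(\zeta^s_i)_{s,i}$. For $i,j\in\{1,\ldots,p\}$ define the $n\times n$ diagonal matrices $$\breve{\mathbf H}_{i,j}=\sum_{s=\max(i,j)}^p\Big(\tfrac{\tau^4}{4}[2(s-i)+1][2(s-j)+1]\,Q_{z,s}+\tau^2Q_{z',s}\Big),$$ $$\mathbf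 G_{i,1}=\tau^2\sum_{s=i}^p\tfrac{2(s-i)+1}{2}Q_{z,s},\qquad \mathbf G_{i,2}=\tau^3\sum_{s=i}^p s\,\tfrac{2(s-i)+1}{2}Q_{z,s}+\tau\sum_{s=i}^pQ_{z',s}.$$ Let $\mathbf H\in\mathbb R^{np\times np}$ be the $p\times p$ block matrix whose $(i,j)$ block is $\breve{\mathbf H}_{i,j}$ for $i\ne j$ and whose $(i,i)$ block is $\breve{\mathbf H}_{i,i}+\tau^2Q_{w,i}$. Let $\mathbf G\in\mathbb R^{np\times 2n}$ be the block matrix whose $i$-th block row is $[\mathbf G_{i,1}\ \ \mathbf G_{i,2}]$, $i=1,\ldots,p$. When $\mathbf H$ is nonsingular, define $$\mathbf K=-\begin{bmatrix}I_n&0&\cdots&0\end{bmatrix}\mathbf H^{-1}\mathbf G\in\mathbb R^{n\times 2n},$$ $$A_{\mathrm c}(\boldsymbol\alpha,\boldsymbol\beta,\boldsymbol\zeta,\tau)=\begin{bmatrix}I_n&\tau I_n\\0&I_n\end{bmatrix}+\begin{bmatrix}\tfrac{\tau^2}{2}I_n\\ \tau I_n\end{bmatrix}\mathbf K\in\mathbb R^{2n\times2n}.$$ This is the closed loop matrix of the unconstrained $p$-horizon model predictive control of the system $z(k+1)=z(k)+\tau z'(k)+\frac{\tau^2}{2}w(k)$, $z'(k+1)=z'(k)+\tau w(k)$. *)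

theory Defs
  imports
    "Jordan_Normal_Form.Gauss_Jordan_Elimination"
    "Jordan_Normal_Form.Spectral_Radius"
begin

text \<open>Block indices, the stage \<open>s\<close> and the agent index of the weights all run from 1, whereas
  matrix entries are numbered from 0.\<close>

text \<open>The \<open>p \<times> q\<close> block matrix whose \<open>(i, j)\<close> block is the \<open>n \<times> n\<close> matrix \<open>B i j\<close>.\<close>

definition block_mat :: "nat \<Rightarrow> nat \<Rightarrow> nat \<Rightarrow> (nat \<Rightarrow> nat \<Rightarrow> 'a mat) \<Rightarrow> 'a mat" where
  "block_mat n p q B =
     mat (p * n) (q * n) (\<lambda>(r, c). B (r div n + 1) (c div n + 1) $$ (r mod n, c mod n))"

text \<open>The sum of a family of \<open>n \<times> n\<close> matrices; the type of matrices of all dimensions has no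
  common zero, so \<open>sum\<close> itself is not available.\<close>

definition msum :: "nat \<Rightarrow> (nat \<Rightarrow> 'a :: comm_monoid_add mat) \<Rightarrow> nat set \<Rightarrow> 'a mat" where
  "msum n M S = mat n n (\<lambda>rc. \<Sum>s\<in>S. M s $$ rc)"

text \<open>A family of weights \<open>w\<close> has \<open>w s i\<close> for the entry with superscript \<open>s\<close> and subscript \<open>i\<close>.
  The matrix \<open>diag (w s 1, \<dots>, w s n)\<close>:\<close>

definition weight_mat :: "nat \<Rightarrow> (nat \<Rightarrow> nat \<Rightarrow> real) \<Rightarrow> nat \<Rightarrow> real mat" where
  "weight_mat n w s = mat_diag n (\<lambda>k. w s (k + 1))"

text \<open>The integer \<open>2 (s - i) + 1\<close>, taken in the reals to avoid truncated subtraction.\<close>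

definition odd_gap :: "nat \<Rightarrow> nat \<Rightarrow> real" where
  "odd_gap s i = 2 * (real s - real i) + 1"

definition H_breve ::
  "nat \<Rightarrow> nat \<Rightarrow> real \<Rightarrow> (nat \<Rightarrow> nat \<Rightarrow> real) \<Rightarrow> (nat \<Rightarrow> nat \<Rightarrow> real) \<Rightarrow> nat \<Rightarrow> nat \<Rightarrow> real mat" where
  "H_breve p n \<tau> \<alpha> \<beta> i j =
     msum n (\<lambda>s. (\<tau> ^ 4 / 4 * odd_gap s i * odd_gap s j) \<cdot>\<^sub>m weight_mat n \<alpha> s
                + \<tau>\<^sup>2 \<cdot>\<^sub>m weight_mat n \<beta> s) {max i j..p}"

definition H_mat ::
  "nat \<Rightarrow> nat \<Rightarrow> real \<Rightarrow> (nat \<Rightarrow> nat \<Rightarrow> real) \<Rightarrow> (nat \<Rightarrow> nat \<Rightarrow> real) \<Rightarrow> (nat \<Rightarrow> nat \<Rightarrow> real) \<Rightarrow> real mat"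
where
  "H_mat p n \<tau> \<alpha> \<beta> \<zeta> =
     block_mat n p p (\<lambda>i j. if i = j then H_breve p n \<tau> \<alpha> \<beta> i i + \<tau>\<^sup>2 \<cdot>\<^sub>m weight_mat n \<zeta> i
                            else H_breve p n \<tau> \<alpha> \<beta> i j)"

definition G1 :: "nat \<Rightarrow> nat \<Rightarrow> real \<Rightarrow> (nat \<Rightarrow> nat \<Rightarrow> real) \<Rightarrow> nat \<Rightarrow> real mat" where
  "G1 p n \<tau> \<alpha> i = \<tau>\<^sup>2 \<cdot>\<^sub>m msum n (\<lambda>s. (odd_gap s i / 2) \<cdot>\<^sub>m weight_mat n \<alpha> s) {i..p}"

definition G2 ::
  "nat \<Rightarrow> nat \<Rightarrow> real \<Rightarrow> (nat \<Rightarrow> nat \<Rightarrow> real) \<Rightarrow> (nat \<Rightarrow> nat \<Rightarrow> real) \<Rightarrow> nat \<Rightarrow> real mat" where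
  "G2 p n \<tau> \<alpha> \<beta> i =
     \<tau> ^ 3 \<cdot>\<^sub>m msum n (\<lambda>s. (real s * (odd_gap s i / 2)) \<cdot>\<^sub>m weight_mat n \<alpha> s) {i..p}
     + \<tau> \<cdot>\<^sub>m msum n (\<lambda>s. weight_mat n \<beta> s) {i..p}"

definition G_mat ::
  "nat \<Rightarrow> nat \<Rightarrow> real \<Rightarrow> (nat \<Rightarrow> nat \<Rightarrow> real) \<Rightarrow> (nat \<Rightarrow> nat \<Rightarrow> real) \<Rightarrow> real mat" where
  "G_mat p n \<tau> \<alpha> \<beta> =
     block_mat n p 2 (\<lambda>i j. if j = 1 then G1 p n \<tau> \<alpha> i else G2 p n \<tau> \<alpha> \<beta> i)"

text \<open>\<open>mat_inverse\<close> returns \<open>None\<close> on singular matrices, so the gain \<open>K\<close> and the closed loop matrix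
  are meaningful only when \<open>H\<close> is invertible.\<close>

definition K_mat ::
  "nat \<Rightarrow> nat \<Rightarrow> real \<Rightarrow> (nat \<Rightarrow> nat \<Rightarrow> real) \<Rightarrow> (nat \<Rightarrow> nat \<Rightarrow> real) \<Rightarrow> (nat \<Rightarrow> nat \<Rightarrow> real) \<Rightarrow> real mat"
where
  "K_mat p n \<tau> \<alpha> \<beta> \<zeta> =
     - (block_mat n 1 p (\<lambda>i j. if j = 1 then 1\<^sub>m n else 0\<^sub>m n n)
        * the (mat_inverse (H_mat p n \<tau> \<alpha> \<beta> \<zeta>)) * G_mat p n \<tau> \<alpha> \<beta>)"

definition A_c ::
  "nat \<Rightarrow> nat \<Rightarrow> (nat \<Rightarrow> nat \<Rightarrow> real) \<Rightarrow> (nat \<Rightarrow> nat \<Rightarrow> real) \<Rightarrow> (nat \<Rightarrow> nat \<Rightarrow> real) \<Rightarrow> real \<Rightarrow> real mat"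
where
  "A_c p n \<alpha> \<beta> \<zeta> \<tau> =
     four_block_mat (1\<^sub>m n) (\<tau> \<cdot>\<^sub>m 1\<^sub>m n) (0\<^sub>m n n) (1\<^sub>m n)
     + (((\<tau>\<^sup>2 / 2) \<cdot>\<^sub>m 1\<^sub>m n) @\<^sub>r (\<tau> \<cdot>\<^sub>m 1\<^sub>m n)) * K_mat p n \<tau> \<alpha> \<beta> \<zeta>"

definition schur_stable :: "real mat \<Rightarrow> bool" where
  "schur_stable A \<longleftrightarrow> spectral_radius (map_mat complex_of_real A) < 1"

end

theory Submission
  imports Defs
begin

text \<open>All weights are diagonal, so the closed loop is a direct sum of \<open>2 \<times> 2\<close> loops, one per agent,
  and such a loop with gain \<open>(k\<^sub>1, k\<^sub>2)\<close> is Schur stable as soon as \<open>k\<^sub>1 < 0\<close>, \<open>\<tau> k\<^sub>2 > -2\<close> and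
  \<open>k\<^sub>2 < \<tau> k\<^sub>1 / 2\<close> (the Jury criterion). These conditions are open. By Cramer's rule the gain depends
  continuously on the weights wherever \<open>det H \<noteq> 0\<close>, and when \<open>\<alpha>\<close> and \<open>\<beta>\<close> vanish at the stages beyond 2
  the gain comes from a \<open>2 \<times> 2\<close> linear system, for which the conditions are polynomial inequalities
  with nonnegative coefficients.\<close>

section \<open>Splitting the closed loop into agents\<close>

text \<open>The matrices of the statement list the agents inside each block. In this ordering a direct sum
  of one matrix per agent has its nonzero entries where row and column agree modulo \<open>n\<close>.\<close>

definition agent_mat :: "nat \<Rightarrow> nat \<Rightarrow> nat \<Rightarrow> (nat \<Rightarrow> 'a :: zero mat) \<Rightarrow> 'a mat" where
  "agent_mat n p q M = mat (p * n) (q * n)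
     (\<lambda>(r, c). if r mod n = c mod n then M (r mod n) $$ (r div n, c div n) else 0)"

lemma agent_mat_carrier [simp]: "agent_mat n p q M \<in> carrier_mat (p * n) (q * n)"
  by (simp add: agent_mat_def)

lemma agent_mat_dim [simp]:
  "dim_row (agent_mat n p q M) = p * n" "dim_col (agent_mat n p q M) = q * n"
  by (simp_all add: agent_mat_def)

section \<open>Algebra of direct sums in the interleaved ordering\<close>

lemma div_less_of_less_mult: "r < p * n \<Longrightarrow> r div n < (p :: nat)"
  by (simp add: less_mult_imp_div_less)

lemma mod_less_of_less_mult: "r < p * n \<Longrightarrow> r mod n < (n :: nat)"
  by (cases "n = 0") auto

text \<open>Indices in the residue class of \<open>i\<close> are exactly \<open>j * n + i\<close>,
  with \<open>j\<close> recovered by \<open>div n\<close>. This collapses a sum over all coordinates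
  to the coordinates of one agent.\<close>

lemma sum_residue_class:
  fixes f :: "nat \<Rightarrow> 'a :: comm_monoid_add"
  assumes "i < n"
  shows "(\<Sum>k\<in>{0..<q * n}. if k mod n = i then f k else 0) = (\<Sum>j\<in>{0..<q}. f (j * n + i))"
proof -
  have "(\<Sum>k\<in>{0..<q * n}. if k mod n = i then f k else 0) = sum f {k\<in>{0..<q * n}. k mod n = i}"
    by (simp add: sum.If_cases Int_def)
  also have "\<dots> = (\<Sum>j\<in>{0..<q}. f (j * n + i))"
  proof (rule sum.reindex_bij_witness[where i = "\<lambda>j. j * n + i" and j = "\<lambda>k. k div n"])
    fix j assume "j \<in> {0..<q}"
    then have "(j + 1) * n \<le> q * n" by (intro mult_le_mono1) auto
    with assms show "j * n + i \<in> {k\<in>{0..<q * n}. k mod n = i}" by auto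
  qed (use assms in \<open>auto simp: div_less_of_less_mult\<close>)
  finally show ?thesis .
qed

lemma agent_mat_cong:
  assumes "\<And>i r c. i < n \<Longrightarrow> r < p \<Longrightarrow> c < q \<Longrightarrow> M i $$ (r, c) = N i $$ (r, c)"
  shows "agent_mat n p q M = agent_mat n p q N"
  by (rule eq_matI)
    (simp_all add: agent_mat_def assms div_less_of_less_mult mod_less_of_less_mult)

text \<open>In the inner sum only those \<open>k\<close> with the residue of the row survive, and
  the column must share that residue, so different agents never mix.\<close>

lemma agent_mat_mult:
  fixes M N :: "nat \<Rightarrow> 'a :: semiring_0 mat"
  assumes M: "\<And>i. i < n \<Longrightarrow> M i \<in> carrier_mat p q" and N: "\<And>i. i < n \<Longrightarrow> N i \<in> carrier_mat q m"
  shows "agent_mat n p q M * agent_mat n q m N = agent_mat n p m (\<lambda>i. M i * N i)"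
proof (rule eq_matI)
  fix r c
  assume "r < dim_row (agent_mat n p m (\<lambda>i. M i * N i))"
    and "c < dim_col (agent_mat n p m (\<lambda>i. M i * N i))"
  then have rc: "r < p * n" "c < m * n" by auto
  define i where "i = r mod n"
  have i: "i < n" using rc by (simp add: i_def mod_less_of_less_mult)
  note bounds = div_less_of_less_mult[OF rc(1)] div_less_of_less_mult[OF rc(2)]
  have "(agent_mat n p q M * agent_mat n q m N) $$ (r, c) =
    (\<Sum>k\<in>{0..<q * n}. if k mod n = i
       then (if c mod n = i then M i $$ (r div n, k div n) * N i $$ (k div n, c div n) else 0) else 0)"
    using rc by (auto simp: agent_mat_def scalar_prod_def i_def intro!: sum.cong)
  also have "\<dots> = (\<Sum>j\<in>{0..<q}.
      if c mod n = i then M i $$ (r div n, j) * N i $$ (j, c div n) else 0)"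
    using i by (subst sum_residue_class) (auto intro!: sum.cong)
  also have "\<dots> = agent_mat n p m (\<lambda>i. M i * N i) $$ (r, c)"
    using rc bounds M[OF i] N[OF i]
    by (auto simp: agent_mat_def scalar_prod_def i_def[symmetric])
  finally show "(agent_mat n p q M * agent_mat n q m N) $$ (r, c) =
    agent_mat n p m (\<lambda>i. M i * N i) $$ (r, c)" .
qed auto

lemma agent_mat_one: "agent_mat n p p (\<lambda>_. 1\<^sub>m p) = (1\<^sub>m (p * n) :: 'a :: semiring_1 mat)"
proof (rule eq_matI)
  fix r c assume "r < dim_row (1\<^sub>m (p * n) :: 'a mat)" "c < dim_col (1\<^sub>m (p * n) :: 'a mat)"
  then have rc: "r < p * n" "c < p * n" by auto
  have "r = c \<longleftrightarrow> r mod n = c mod n \<and> r div n = c div n"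
    by (metis div_mult_mod_eq)
  then show "agent_mat n p p (\<lambda>_. 1\<^sub>m p) $$ (r, c) = (1\<^sub>m (p * n) :: 'a mat) $$ (r, c)"
    using rc by (auto simp: agent_mat_def div_less_of_less_mult)
qed auto

lemma agent_mat_uminus:
  fixes M :: "nat \<Rightarrow> 'a :: group_add mat"
  assumes "\<And>i. i < n \<Longrightarrow> M i \<in> carrier_mat p q"
  shows "- agent_mat n p q M = agent_mat n p q (\<lambda>i. - M i)"
proof (rule eq_matI)
  fix r c
  assume "r < dim_row (agent_mat n p q (\<lambda>i. - M i))" "c < dim_col (agent_mat n p q (\<lambda>i. - M i))"
  then have rc: "r < p * n" "c < q * n" by auto
  then show "(- agent_mat n p q M) $$ (r, c) = agent_mat n p q (\<lambda>i. - M i) $$ (r, c)"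
    using assms[OF mod_less_of_less_mult[OF rc(1)]]
    by (auto simp: agent_mat_def div_less_of_less_mult)
qed auto

lemma agent_mat_add:
  fixes M N :: "nat \<Rightarrow> 'a :: monoid_add mat"
  assumes "\<And>i. i < n \<Longrightarrow> N i \<in> carrier_mat p q"
  shows "agent_mat n p q M + agent_mat n p q N = agent_mat n p q (\<lambda>i. M i + N i)"
proof (rule eq_matI)
  fix r c
  assume "r < dim_row (agent_mat n p q (\<lambda>i. M i + N i))"
    and "c < dim_col (agent_mat n p q (\<lambda>i. M i + N i))"
  then have rc: "r < p * n" "c < q * n" by auto
  then show "(agent_mat n p q M + agent_mat n p q N) $$ (r, c) =
      agent_mat n p q (\<lambda>i. M i + N i) $$ (r, c)"
    using assms[OF mod_less_of_less_mult[OF rc(1)]]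
    by (auto simp: agent_mat_def div_less_of_less_mult)
qed auto

lemma agent_mat_map:
  assumes "\<And>i. i < n \<Longrightarrow> M i \<in> carrier_mat p q" and "f 0 = 0"
  shows "map_mat f (agent_mat n p q M) = agent_mat n p q (\<lambda>i. map_mat f (M i))"
proof (rule eq_matI)
  fix r c
  assume "r < dim_row (agent_mat n p q (\<lambda>i. map_mat f (M i)))"
    and "c < dim_col (agent_mat n p q (\<lambda>i. map_mat f (M i)))"
  then have rc: "r < p * n" "c < q * n" by auto
  then show "map_mat f (agent_mat n p q M) $$ (r, c) =
      agent_mat n p q (\<lambda>i. map_mat f (M i)) $$ (r, c)"
    using assms(1)[OF mod_less_of_less_mult[OF rc(1)]] assms(2)
    by (auto simp: agent_mat_def div_less_of_less_mult)
qed auto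

text \<open>An eigenvector of the direct sum, restricted to the residue class of one of its nonzero
  coordinates, stays nonzero and is an eigenvector of that agent's matrix.\<close>

lemma eigenvalue_agent_mat:
  fixes M :: "nat \<Rightarrow> 'a :: comm_ring_1 mat"
  assumes M: "\<And>i. i < n \<Longrightarrow> M i \<in> carrier_mat p p"
    and ev: "eigenvalue (agent_mat n p p M) l"
  shows "\<exists>i<n. eigenvalue (M i) l"
proof -
  obtain v where v: "v \<in> carrier_vec (p * n)" "v \<noteq> 0\<^sub>v (p * n)"
      "agent_mat n p p M *\<^sub>v v = l \<cdot>\<^sub>v v"
    using ev by (auto simp: eigenvalue_def eigenvector_def)
  obtain m where m: "m < p * n" "v $ m \<noteq> 0"
    using v(1,2) by (metis carrier_vecD eq_vecI index_zero_vec(1) index_zero_vec(2))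
  define i where "i = m mod n"
  have i: "i < n" using m(1) by (simp add: i_def mod_less_of_less_mult)
  define w where "w = vec p (\<lambda>k. v $ (k * n + i))"
  have "w $ (m div n) \<noteq> 0"
    using m by (simp add: w_def i_def div_less_of_less_mult)
  then have "w \<noteq> 0\<^sub>v p"
    using m(1) by (auto simp: div_less_of_less_mult)
  then have w: "w \<in> carrier_vec p" "w \<noteq> 0\<^sub>v p" by (simp_all add: w_def)
  have "M i *\<^sub>v w = l \<cdot>\<^sub>v w"
  proof (rule eq_vecI)
    fix k assume "k < dim_vec (l \<cdot>\<^sub>v w)"
    then have k: "k < p" by (simp add: w_def)
    then have "(k + 1) * n \<le> p * n" by (intro mult_le_mono1) auto
    then have kn: "k * n + i < p * n" using i by simp
    have "(l \<cdot>\<^sub>v w) $ k = (agent_mat n p p M *\<^sub>v v) $ (k * n + i)"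
      using k kn v(1,3) by (simp add: w_def)
    also have "\<dots> = (\<Sum>c\<in>{0..<p * n}. if c mod n = i then M i $$ (k, c div n) * v $ c else 0)"
      using kn i v(1) by (auto simp: agent_mat_def scalar_prod_def intro!: sum.cong)
    also have "\<dots> = (M i *\<^sub>v w) $ k"
      using i k M[OF i]
      by (subst sum_residue_class) (auto simp: scalar_prod_def w_def intro!: sum.cong)
    finally show "(M i *\<^sub>v w) $ k = (l \<cdot>\<^sub>v w) $ k" by simp
  qed (use M[OF i] in \<open>auto simp: w_def\<close>)
  then have "eigenvector (M i) w l"
    using w M[OF i] by (simp add: eigenvector_def)
  then show ?thesis using i by (auto simp: eigenvalue_def)
qed

text \<open>In the agent matrices rows and columns count from 0 while stages count from 1, whence the
  shifts by 1.\<close>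

definition agent_H ::
  "nat \<Rightarrow> real \<Rightarrow> (nat \<Rightarrow> real) \<Rightarrow> (nat \<Rightarrow> real) \<Rightarrow> (nat \<Rightarrow> real) \<Rightarrow> real mat" where
  "agent_H p \<tau> a b z = mat p p (\<lambda>(r, c).
     (\<Sum>s\<in>{max (r + 1) (c + 1)..p}.
        \<tau> ^ 4 / 4 * odd_gap s (r + 1) * odd_gap s (c + 1) * a s + \<tau>\<^sup>2 * b s)
     + (if r = c then \<tau>\<^sup>2 * z (r + 1) else 0))"

definition agent_G :: "nat \<Rightarrow> real \<Rightarrow> (nat \<Rightarrow> real) \<Rightarrow> (nat \<Rightarrow> real) \<Rightarrow> real mat" where
  "agent_G p \<tau> a b = mat p 2 (\<lambda>(r, j).
     if j = 0 then \<tau>\<^sup>2 * (\<Sum>s\<in>{r + 1..p}. odd_gap s (r + 1) / 2 * a s)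
     else \<tau> ^ 3 * (\<Sum>s\<in>{r + 1..p}. real s * (odd_gap s (r + 1) / 2) * a s)
          + \<tau> * (\<Sum>s\<in>{r + 1..p}. b s))"

definition first_row :: "nat \<Rightarrow> real mat" where
  "first_row p = mat 1 p (\<lambda>(r, c). if c = 0 then 1 else 0)"

text \<open>The adjugate form of the inverse: its entries are quotients of polynomials in the
  entries of \<open>A\<close>, which makes continuity visible. For singular \<open>A\<close> it is
  the zero matrix.\<close>

definition inv_det :: "real mat \<Rightarrow> real mat" where
  "inv_det A = (1 / det A) \<cdot>\<^sub>m adj_mat A"

definition agent_K ::
  "nat \<Rightarrow> real \<Rightarrow> (nat \<Rightarrow> real) \<Rightarrow> (nat \<Rightarrow> real) \<Rightarrow> (nat \<Rightarrow> real) \<Rightarrow> real mat" where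
  "agent_K p \<tau> a b z = - (first_row p * inv_det (agent_H p \<tau> a b z) * agent_G p \<tau> a b)"

text \<open>The closed loop of one double integrator, as a function of the gain row \<open>k\<close>
  alone.\<close>

definition agent_A :: "real \<Rightarrow> real mat \<Rightarrow> real mat" where
  "agent_A \<tau> k = mat 2 2 (\<lambda>(r, c). if r = c then 1 else if r = 0 then \<tau> else 0)
     + mat 2 1 (\<lambda>(r, c). if r = 0 then \<tau>\<^sup>2 / 2 else \<tau>) * k"

section \<open>The closed loop as the direct sum of the agents' loops\<close>

lemma agent_carriers [simp]:
  "agent_H p \<tau> a b z \<in> carrier_mat p p" "agent_G p \<tau> a b \<in> carrier_mat p 2"
  "first_row p \<in> carrier_mat 1 p"
  by (simp_all add: agent_H_def agent_G_def first_row_def)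

lemma inv_det:
  assumes A: "A \<in> carrier_mat p p"
  shows "inv_det A \<in> carrier_mat p p"
    and "det A \<noteq> 0 \<Longrightarrow> A * inv_det A = 1\<^sub>m p" "det A \<noteq> 0 \<Longrightarrow> inv_det A * A = 1\<^sub>m p"
proof -
  note adj = adj_mat[OF A]
  show "inv_det A \<in> carrier_mat p p"
    using adj(1) by (simp add: inv_det_def)
  assume d: "det A \<noteq> 0"
  show "A * inv_det A = 1\<^sub>m p"
    using adj d unfolding inv_det_def mult_smult_distrib[OF A adj(1)] by (intro eq_matI) auto
  show "inv_det A * A = 1\<^sub>m p"
    using adj d unfolding inv_det_def mult_smult_assoc_mat[OF adj(1) A] by (intro eq_matI) auto
qed

lemma agent_K_carrier: "agent_K p \<tau> a b z \<in> carrier_mat 1 2"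
  unfolding agent_K_def
  by (intro uminus_carrier_mat mult_carrier_mat[of _ _ p] agent_carriers inv_det(1))

lemma weight_mat_index [simp]:
  "i < n \<Longrightarrow> j < n \<Longrightarrow> weight_mat n w s $$ (i, j) = (if i = j then w s (i + 1) else 0)"
  "dim_row (weight_mat n w s) = n" "dim_col (weight_mat n w s) = n"
  by (simp_all add: weight_mat_def mat_diag_def)

lemma msum_index [simp]:
  "i < n \<Longrightarrow> j < n \<Longrightarrow> msum n M S $$ (i, j) = (\<Sum>s\<in>S. M s $$ (i, j))"
  "dim_row (msum n M S) = n" "dim_col (msum n M S) = n"
  by (simp_all add: msum_def)

text \<open>Every block is a combination of diagonal weight matrices, hence zero wherever row and
  column belong to different agents.\<close>

lemma H_mat_agents:
  "H_mat p n \<tau> \<alpha> \<beta> \<zeta> =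
    agent_mat n p p (\<lambda>i. agent_H p \<tau> (\<lambda>s. \<alpha> s (i + 1)) (\<lambda>s. \<beta> s (i + 1)) (\<lambda>s. \<zeta> s (i + 1)))"
  by (rule eq_matI)
    (auto simp: H_mat_def block_mat_def agent_mat_def agent_H_def H_breve_def
      div_less_of_less_mult mod_less_of_less_mult intro!: sum.cong)

lemma G_mat_agents:
  "G_mat p n \<tau> \<alpha> \<beta> =
    agent_mat n p 2 (\<lambda>i. agent_G p \<tau> (\<lambda>s. \<alpha> s (i + 1)) (\<lambda>s. \<beta> s (i + 1)))"
proof (rule eq_matI)
  fix r c
  assume "r < dim_row (agent_mat n p 2 (\<lambda>i. agent_G p \<tau> (\<lambda>s. \<alpha> s (i + 1)) (\<lambda>s. \<beta> s (i + 1))))"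
    and "c < dim_col (agent_mat n p 2 (\<lambda>i. agent_G p \<tau> (\<lambda>s. \<alpha> s (i + 1)) (\<lambda>s. \<beta> s (i + 1))))"
  then have rc: "r < p * n" "c < 2 * n" by auto
  note bounds = div_less_of_less_mult[OF rc(1)] div_less_of_less_mult[OF rc(2)]
    mod_less_of_less_mult[OF rc(1)] mod_less_of_less_mult[OF rc(2)]
  show "G_mat p n \<tau> \<alpha> \<beta> $$ (r, c) =
      agent_mat n p 2 (\<lambda>i. agent_G p \<tau> (\<lambda>s. \<alpha> s (i + 1)) (\<lambda>s. \<beta> s (i + 1))) $$ (r, c)"
    using rc bounds
    by (auto simp: G_mat_def block_mat_def agent_mat_def agent_G_def G1_def G2_def)
qed (auto simp: G_mat_def block_mat_def)

lemma first_row_agents: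
  "block_mat n 1 p (\<lambda>i j. if j = 1 then 1\<^sub>m n else 0\<^sub>m n n) = agent_mat n 1 p (\<lambda>_. first_row p)"
  by (rule eq_matI)
    (auto simp: block_mat_def agent_mat_def first_row_def div_less_of_less_mult
      mod_less_of_less_mult div_eq_0_iff)

lemma agent_A_carrier [simp]: "agent_A \<tau> k \<in> carrier_mat 2 (dim_col k)"
  by (auto simp: agent_A_def)

text \<open>The direct sum of the agents' inverses is a two-sided inverse of \<open>H_mat\<close>.
  Once it is identified with the result of \<open>mat_inverse\<close>, every factor of
  \<open>A_c\<close> is a direct sum, and so are products and sums of them.\<close>

lemma closed_loop_agents:
  assumes det: "\<And>i. i < n \<Longrightarrow>
    det (agent_H p \<tau> (\<lambda>s. \<alpha> s (i + 1)) (\<lambda>s. \<beta> s (i + 1)) (\<lambda>s. \<zeta> s (i + 1))) \<noteq> 0"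
  shows "invertible_mat (H_mat p n \<tau> \<alpha> \<beta> \<zeta>)"
    and "A_c p n \<alpha> \<beta> \<zeta> \<tau> = agent_mat n 2 2 (\<lambda>i. agent_A \<tau>
      (agent_K p \<tau> (\<lambda>s. \<alpha> s (i + 1)) (\<lambda>s. \<beta> s (i + 1)) (\<lambda>s. \<zeta> s (i + 1))))"
proof -
  define h where "h i = agent_H p \<tau> (\<lambda>s. \<alpha> s (i + 1)) (\<lambda>s. \<beta> s (i + 1)) (\<lambda>s. \<zeta> s (i + 1))" for i
  define g where "g i = agent_G p \<tau> (\<lambda>s. \<alpha> s (i + 1)) (\<lambda>s. \<beta> s (i + 1))" for i
  define k where "k i = agent_K p \<tau> (\<lambda>s. \<alpha> s (i + 1)) (\<lambda>s. \<beta> s (i + 1)) (\<lambda>s. \<zeta> s (i + 1))" for i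
  define X where "X = agent_mat n p p (\<lambda>i. inv_det (h i))"
  have H: "H_mat p n \<tau> \<alpha> \<beta> \<zeta> = agent_mat n p p h"
    by (simp add: H_mat_agents h_def[abs_def])
  have hc: "h i \<in> carrier_mat p p" for i by (simp add: h_def)
  have hd: "i < n \<Longrightarrow> det (h i) \<noteq> 0" for i using det by (simp add: h_def)
  have one: "agent_mat n p p (\<lambda>i. h i * inv_det (h i)) = 1\<^sub>m (p * n)"
    "agent_mat n p p (\<lambda>i. inv_det (h i) * h i) = 1\<^sub>m (p * n)"
    unfolding agent_mat_one[symmetric]
    using inv_det(2,3)[OF hc hd] by (auto intro!: agent_mat_cong)
  have HX: "H_mat p n \<tau> \<alpha> \<beta> \<zeta> * X = 1\<^sub>m (p * n)"
    unfolding H X_def by (subst agent_mat_mult[OF hc inv_det(1)[OF hc]]) (rule one)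
  have XH: "X * H_mat p n \<tau> \<alpha> \<beta> \<zeta> = 1\<^sub>m (p * n)"
    unfolding H X_def by (subst agent_mat_mult[OF inv_det(1)[OF hc] hc]) (rule one)
  show "invertible_mat (H_mat p n \<tau> \<alpha> \<beta> \<zeta>)"
    unfolding invertible_mat_def inverts_mat_def
    using HX XH by (intro conjI exI[of _ X]) (auto simp: H X_def)
  have Hc: "H_mat p n \<tau> \<alpha> \<beta> \<zeta> \<in> carrier_mat (p * n) (p * n)" by (simp add: H)
  have Xc: "X \<in> carrier_mat (p * n) (p * n)" by (simp add: X_def)
  \<comment> \<open>\<open>None\<close> would mean that \<open>H_mat\<close> is not a unit of the
    matrix ring, which \<open>X\<close> refutes; a result \<open>Y\<close> equals \<open>X\<close>
    by uniqueness of inverses.\<close>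
  have inv: "mat_inverse (H_mat p n \<tau> \<alpha> \<beta> \<zeta>) = Some X"
  proof (cases "mat_inverse (H_mat p n \<tau> \<alpha> \<beta> \<zeta>)")
    case None
    from mat_inverse(1)[OF Hc this, of "()"] HX XH Hc Xc show ?thesis
      by (auto simp: Units_def ring_mat_def)
  next
    case (Some Y)
    note Y = mat_inverse(2)[OF Hc Some]
    have "X = X * (H_mat p n \<tau> \<alpha> \<beta> \<zeta> * Y)" using Y Xc by simp
    also have "\<dots> = X * H_mat p n \<tau> \<alpha> \<beta> \<zeta> * Y"
      using Y by (intro assoc_mult_mat[OF Xc Hc, symmetric]) auto
    also have "\<dots> = Y" unfolding XH using Y by (intro left_mult_one_mat) auto
    finally show ?thesis using Some by simp
  qed
  have gc: "g i \<in> carrier_mat p 2" for i by (simp add: g_def)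
  have rc: "first_row p * inv_det (h i) \<in> carrier_mat 1 p" for i
    by (intro mult_carrier_mat[of _ _ p] agent_carriers inv_det(1)[OF hc])
  have "agent_mat n 1 p (\<lambda>_. first_row p) * X =
      agent_mat n 1 p (\<lambda>i. first_row p * inv_det (h i))"
    unfolding X_def by (rule agent_mat_mult[OF agent_carriers(3) inv_det(1)[OF hc]])
  moreover have "agent_mat n 1 p (\<lambda>i. first_row p * inv_det (h i)) * agent_mat n p 2 g =
      agent_mat n 1 2 (\<lambda>i. first_row p * inv_det (h i) * g i)"
    by (rule agent_mat_mult[OF rc gc])
  moreover have "- agent_mat n 1 2 (\<lambda>i. first_row p * inv_det (h i) * g i) =
      agent_mat n 1 2 (\<lambda>i. - (first_row p * inv_det (h i) * g i))"
    by (rule agent_mat_uminus[OF mult_carrier_mat[OF rc gc]])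
  ultimately have K: "K_mat p n \<tau> \<alpha> \<beta> \<zeta> = agent_mat n 1 2 k"
    unfolding K_mat_def inv option.sel first_row_agents G_mat_agents k_def[abs_def]
      agent_K_def h_def[symmetric] g_def[symmetric] by simp
  have drift: "four_block_mat (1\<^sub>m n) (\<tau> \<cdot>\<^sub>m 1\<^sub>m n) (0\<^sub>m n n) (1\<^sub>m n) =
      agent_mat n 2 2 (\<lambda>_. mat 2 2 (\<lambda>(r, c). if r = c then 1 else if r = 0 then \<tau> else 0))"
  proof (rule eq_matI)
    fix r c
    assume "r < dim_row (agent_mat n 2 2 (\<lambda>_. mat 2 2 (\<lambda>(r, c). if r = c then 1 else if r = 0 then \<tau> else 0)))"
      and "c < dim_col (agent_mat n 2 2 (\<lambda>_. mat 2 2 (\<lambda>(r, c). if r = c then 1 else if r = 0 then \<tau> else 0)))"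
    then have rc: "r < 2 * n" "c < 2 * n" by auto
    have div: "q div n = (if q < n then 0 else 1)" "q mod n = (if q < n then q else q - n)"
      if "q < 2 * n" for q
      using that by (auto simp: div_nat_eqI le_mod_geq)
    show "four_block_mat (1\<^sub>m n) (\<tau> \<cdot>\<^sub>m 1\<^sub>m n) (0\<^sub>m n n) (1\<^sub>m n) $$ (r, c) = agent_mat n 2 2 (\<lambda>_. mat 2 2 (\<lambda>(r, c). if r = c then 1 else if r = 0 then \<tau> else 0)) $$ (r, c)"
      using rc by (auto simp: agent_mat_def div )
  qed (auto)
  have input: "((\<tau>\<^sup>2 / 2) \<cdot>\<^sub>m 1\<^sub>m n) @\<^sub>r (\<tau> \<cdot>\<^sub>m 1\<^sub>m n) =
      agent_mat n 2 1 (\<lambda>_. mat 2 1 (\<lambda>(r, c). if r = 0 then \<tau>\<^sup>2 / 2 else \<tau>))"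
  proof (rule eq_matI)
    fix r c
    assume "r < dim_row (agent_mat n 2 1 (\<lambda>_. mat 2 1 (\<lambda>(r, c). if r = 0 then \<tau>\<^sup>2 / 2 else \<tau>)))"
      and "c < dim_col (agent_mat n 2 1 (\<lambda>_. mat 2 1 (\<lambda>(r, c). if r = 0 then \<tau>\<^sup>2 / 2 else \<tau>)))"
    then have rc: "r < 2 * n" "c < 1 * n" by auto
    have div: "q div n = (if q < n then 0 else 1)" "q mod n = (if q < n then q else q - n)"
      if "q < 2 * n" for q
      using that by (auto simp: div_nat_eqI le_mod_geq)
    show "(((\<tau>\<^sup>2 / 2) \<cdot>\<^sub>m 1\<^sub>m n) @\<^sub>r (\<tau> \<cdot>\<^sub>m 1\<^sub>m n)) $$ (r, c) = agent_mat n 2 1 (\<lambda>_. mat 2 1 (\<lambda>(r, c). if r = 0 then \<tau>\<^sup>2 / 2 else \<tau>)) $$ (r, c)"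
      using rc by (auto simp: agent_mat_def div append_rows_def)
  qed (auto simp: append_rows_def)
  have kc: "k i \<in> carrier_mat 1 2" for i by (simp only: k_def agent_K_carrier)
  show "A_c p n \<alpha> \<beta> \<zeta> \<tau> = agent_mat n 2 2 (\<lambda>i. agent_A \<tau>
      (agent_K p \<tau> (\<lambda>s. \<alpha> s (i + 1)) (\<lambda>s. \<beta> s (i + 1)) (\<lambda>s. \<zeta> s (i + 1))))"
    unfolding A_c_def K drift input k_def[symmetric] agent_A_def
    by (subst agent_mat_mult[OF _ kc], simp, subst agent_mat_add)
      (auto intro!: mult_carrier_mat[OF _ kc])
qed

section \<open>The Jury criterion and the horizon 2\<close>

text \<open>For a non-real root the imaginary part of the equation forces \<open>t = 2 * u\<close>,
  and then the squared modulus is \<open>d\<close>. For a real root with modulus at least 1, the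
  bound on \<open>t\<close> makes the quadratic larger than
  \<open>(\<bar>u\<bar> - 1) * (\<bar>u\<bar> - d)\<close>, which is nonnegative.\<close>

lemma quadratic_root_in_disc:
  fixes x :: complex and t d :: real
  assumes root: "x\<^sup>2 - of_real t * x + of_real d = 0"
    and t: "\<bar>t\<bar> < 1 + d" and d: "d < 1"
  shows "norm x < 1"
proof -
  obtain u v where x: "x = Complex u v" by (cases x)
  have re: "u\<^sup>2 - v\<^sup>2 - t * u + d = 0" and im: "v * (2 * u - t) = 0"
    using root unfolding x by (simp_all add: complex_eq_iff power2_eq_square algebra_simps)
  have "u\<^sup>2 + v\<^sup>2 < 1"
  proof (cases "v = 0")
    case True
    have "\<bar>u\<bar> < 1"
    proof (rule ccontr)
      assume "\<not> \<bar>u\<bar> < 1"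
      then have "(\<bar>u\<bar> - 1) * (\<bar>u\<bar> - d) \<ge> 0" using d by simp
      moreover have "t * u \<le> \<bar>t\<bar> * \<bar>u\<bar>" by (metis abs_ge_self abs_mult)
      moreover have "\<bar>t\<bar> * \<bar>u\<bar> < (1 + d) * \<bar>u\<bar>"
        using t \<open>\<not> \<bar>u\<bar> < 1\<close> by (intro mult_strict_right_mono) auto
      moreover have "\<bar>u\<bar> * \<bar>u\<bar> = u * u" by simp
      ultimately show False using re True by (simp add: power2_eq_square algebra_simps)
    qed
    then show ?thesis using True by (simp add: abs_square_less_1)
  next
    case False
    then have "t = 2 * u" using im by simp
    then show ?thesis using re d by (simp add: power2_eq_square)
  qed
  then show ?thesis by (simp add: x cmod_def)
qed

lemma eigenvalue_2x2:
  fixes A :: "'a :: field mat"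
  assumes A: "A \<in> carrier_mat 2 2" and ev: "eigenvalue A l"
  shows "l\<^sup>2 - (A $$ (0,0) + A $$ (1,1)) * l
      + (A $$ (0,0) * A $$ (1,1) - A $$ (0,1) * A $$ (1,0)) = 0"
proof -
  obtain v where v: "v \<in> carrier_vec 2" "v \<noteq> 0\<^sub>v 2" "A *\<^sub>v v = l \<cdot>\<^sub>v v"
    using ev A by (auto simp: eigenvalue_def eigenvector_def)
  have row: "A $$ (r,0) * v $ 0 + A $$ (r,1) * v $ 1 = l * v $ r" if "r < 2" for r
    using arg_cong[OF v(3), of "\<lambda>w. w $ r"] A v(1) that
    by (simp add: scalar_prod_def numeral_2_eq_2)
  have ne: "v $ 0 \<noteq> 0 \<or> v $ 1 \<noteq> 0"
    using v(1,2) by (auto simp: vec_eq_iff less_2_cases_iff)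
  let ?q = "l\<^sup>2 - (A $$ (0,0) + A $$ (1,1)) * l
      + (A $$ (0,0) * A $$ (1,1) - A $$ (0,1) * A $$ (1,0))"
  \<comment> \<open>Combining the two rows of the eigenvector equation with the entries of the
    adjugate of \<open>l I - A\<close> isolates each coordinate of \<open>v\<close>, multiplied by
    the characteristic polynomial at \<open>l\<close>.\<close>
  have "?q * v $ 0 = (l - A $$ (1,1)) * (l * v $ 0 - (A $$ (0,0) * v $ 0 + A $$ (0,1) * v $ 1))
      + A $$ (0,1) * (l * v $ 1 - (A $$ (1,0) * v $ 0 + A $$ (1,1) * v $ 1))"
    and "?q * v $ 1 = (l - A $$ (0,0)) * (l * v $ 1 - (A $$ (1,0) * v $ 0 + A $$ (1,1) * v $ 1))
      + A $$ (1,0) * (l * v $ 0 - (A $$ (0,0) * v $ 0 + A $$ (0,1) * v $ 1))"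
    by (simp_all add: power2_eq_square algebra_simps)
  then have "?q * v $ 0 = 0" "?q * v $ 1 = 0"
    by (simp_all add: row[of 0, simplified] row[of 1, simplified])
  then show ?thesis using ne by auto
qed

text \<open>The pair \<open>(y0, y1)\<close> is the first row of the inverse of the symmetric matrix
  with entries \<open>h00\<close>, \<open>h01\<close>, \<open>h11\<close>; the three bounds are the
  Jury conditions for the resulting gain. After multiplication by the determinant they compare
  polynomials, and each difference has nonnegative coefficients and a strictly positive
  term.\<close>

lemma two_stage_gain_bounds:
  fixes a1 b1 c1 a2 b2 c2 y0 y1 h00 h01 h11 :: real
  assumes h: "h00 = a1 / 4 + b1 + (9 / 4 * a2 + b2) + c1" "h01 = 3 / 4 * a2 + b2"
      "h11 = a2 / 4 + b2 + c2"
    and pos: "a1 > 0" "b1 > 0" "c1 > 0" "a2 \<ge> 0" "b2 \<ge> 0" "c2 \<ge> 0" "a2 + b2 + c2 > 0"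
  shows "h00 * h11 - h01 * h01 > 0"
    and "y0 * h00 + y1 * h01 = 1 \<Longrightarrow> y0 * h01 + y1 * h11 = 0 \<Longrightarrow>
      y0 * (a1 / 2 + 3 / 2 * a2) + y1 * (a2 / 2) > 0 \<and>
      y0 * (a1 / 2 + 3 * a2 + b1 + b2) + y1 * (a2 + b2) < 2 \<and>
      y0 * (a1 / 2 + 3 * a2 + b1 + b2) + y1 * (a2 + b2)
        > (y0 * (a1 / 2 + 3 / 2 * a2) + y1 * (a2 / 2)) / 2"
proof -
  define D where "D = h00 * h11 - h01 * h01"
  \<comment> \<open>Here it matters that the weights of stage 2 are not all zero.\<close>
  have h11: "h11 > 0" using pos by (simp add: h)
  have nn: "a2 * b2 \<ge> 0" "c2 * a2 \<ge> 0" "c2 * b2 \<ge> 0" "a1 * h11 > 0" "b1 * h11 > 0" "c1 * h11 > 0"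
    using pos h11 by simp_all
  \<comment> \<open>The squares of \<open>a2\<close> and \<open>b2\<close> cancel between
    \<open>h00 * h11\<close> and \<open>h01 * h01\<close>, and the mixed term is left with
    coefficient 1.\<close>
  have D: "D = a1 * h11 / 4 + b1 * h11 + c1 * h11 + 9 / 4 * (c2 * a2) + c2 * b2 + a2 * b2"
    unfolding D_def h by (simp add: field_simps)
  then have Dpos: "D > 0" using nn by linarith
  then show "h00 * h11 - h01 * h01 > 0" by (simp add: D_def)
  assume y: "y0 * h00 + y1 * h01 = 1" "y0 * h01 + y1 * h11 = 0"
  have "D * y0 = h11 * (y0 * h00 + y1 * h01) - h01 * (y0 * h01 + y1 * h11)"
    and "D * y1 = h00 * (y0 * h01 + y1 * h11) - h01 * (y0 * h00 + y1 * h01)"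
    by (simp_all add: D_def algebra_simps)
  then have Dy: "D * y0 = h11" "D * y1 = - h01" using y by simp_all
  define P where "P = y0 * (a1 / 2 + 3 / 2 * a2) + y1 * (a2 / 2)"
  define Q where "Q = y0 * (a1 / 2 + 3 * a2 + b1 + b2) + y1 * (a2 + b2)"
  have "D * P = h11 * (a1 / 2 + 3 / 2 * a2) - h01 * (a2 / 2)"
    by (simp add: P_def distrib_left mult.assoc[symmetric] Dy)
  also have "\<dots> = a1 * h11 / 2 + a2 * b2 + 3 / 2 * (c2 * a2)"
    unfolding h by (simp add: field_simps)
  finally have DP: "D * P = a1 * h11 / 2 + a2 * b2 + 3 / 2 * (c2 * a2)" .
  have "D * Q = h11 * (a1 / 2 + 3 * a2 + b1 + b2) - h01 * (a2 + b2)"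
    by (simp add: Q_def distrib_left mult.assoc[symmetric] Dy)
  also have "\<dots> = a1 * h11 / 2 + b1 * h11 + 3 * (c2 * a2) + c2 * b2 + 3 / 2 * (a2 * b2)"
    unfolding h by (simp add: field_simps)
  finally have DQ: "D * Q =
    a1 * h11 / 2 + b1 * h11 + 3 * (c2 * a2) + c2 * b2 + 3 / 2 * (a2 * b2)" .
  have "D * P > 0" using nn unfolding DP by linarith
  moreover have "D * 2 - D * Q > 0" "D * Q - D * P / 2 > 0" using nn D DQ DP by linarith+
  then have "D * (2 - Q) > 0" "D * (Q - P / 2) > 0" by (simp_all add: right_diff_distrib)
  ultimately have "P > 0" "2 - Q > 0" "Q - P / 2 > 0" using Dpos by (simp_all add: zero_less_mult_iff)
  then show "P > 0 \<and> Q < 2 \<and> Q > P / 2" by simp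
qed

section \<open>Small weights beyond stage 2\<close>

text \<open>By the Leibniz formula the determinant is a polynomial in the entries.\<close>

lemma tendsto_det:
  fixes A :: "'x \<Rightarrow> 'a :: real_normed_field mat"
  assumes "\<And>x. A x \<in> carrier_mat n n" "L \<in> carrier_mat n n"
    and "\<And>i j. i < n \<Longrightarrow> j < n \<Longrightarrow> ((\<lambda>x. A x $$ (i, j)) \<longlongrightarrow> L $$ (i, j)) F"
  shows "((\<lambda>x. det (A x)) \<longlongrightarrow> det L) F"
  unfolding det_def'[OF assms(1)] det_def'[OF assms(2)]
  by (intro tendsto_sum tendsto_mult tendsto_const tendsto_prod assms(3))
    (auto dest: permutes_in_image)

lemma tendsto_cofactor:
  fixes A :: "'x \<Rightarrow> 'a :: real_normed_field mat"
  assumes A: "\<And>x. A x \<in> carrier_mat n n" and L: "L \<in> carrier_mat n n"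
    and lim: "\<And>i j. i < n \<Longrightarrow> j < n \<Longrightarrow> ((\<lambda>x. A x $$ (i, j)) \<longlongrightarrow> L $$ (i, j)) F"
    and rc: "r < n" "c < n"
  shows "((\<lambda>x. cofactor (A x) r c) \<longlongrightarrow> cofactor L r c) F"
  unfolding cofactor_def
proof (intro tendsto_mult tendsto_const tendsto_det[where n = "n - 1"])
  fix i j assume "i < n - 1" "j < n - 1"
  then show "((\<lambda>x. mat_delete (A x) r c $$ (i, j)) \<longlongrightarrow> mat_delete L r c $$ (i, j)) F"
    using rc by (auto simp: mat_delete_def carrier_matD[OF A] carrier_matD[OF L] intro!: lim)
qed (simp_all add: mat_delete_def carrier_matD[OF A] carrier_matD[OF L])

section \<open>Gain entries and stability of a single loop\<close>

lemma agent_K_index: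
  assumes "p \<ge> 1" "j < 2"
  shows "agent_K p \<tau> a b z $$ (0, j) =
    - (\<Sum>r<p. inv_det (agent_H p \<tau> a b z) $$ (0, r) * agent_G p \<tau> a b $$ (r, j))"
proof -
  define X where "X = inv_det (agent_H p \<tau> a b z)"
  have X: "X \<in> carrier_mat p p" by (simp add: X_def inv_det(1))
  have "(first_row p * X) $$ (0, r) = X $$ (0, r)" if "r < p" for r
  proof -
    have "(first_row p * X) $$ (0, r) = (\<Sum>c\<in>{0..<p}. (if c = 0 then 1 else 0) * X $$ (c, r))"
      using X that by (simp add: first_row_def scalar_prod_def)
    also have "\<dots> = (\<Sum>c\<in>{0..<p}. if c = 0 then X $$ (c, r) else 0)"
      by (intro sum.cong) auto
    finally show ?thesis using assms by simp
  qed
  then show ?thesis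
    using X assms carrier_matD[OF agent_carriers(2)[of p \<tau> a b]]
    by (simp add: agent_K_def X_def[symmetric] scalar_prod_def first_row_def atLeast0LessThan)
qed

lemma agent_A_index:
  assumes "k \<in> carrier_mat 1 2" "r < 2" "c < 2"
  shows "agent_A \<tau> k $$ (r, c) = (if r = c then 1 else if r = 0 then \<tau> else 0)
    + (if r = 0 then \<tau>\<^sup>2 / 2 else \<tau>) * k $$ (0, c)"
  using assms by (simp add: agent_A_def scalar_prod_def)

text \<open>With trace \<open>t\<close> and determinant \<open>d\<close> of the loop and gains
  \<open>k1\<close>, \<open>k2\<close>, one finds \<open>1 + d - t = - \<tau>\<^sup>2 * k1\<close>
  and \<open>1 + d + t = 4 + 2 * \<tau> * k2\<close>, while \<open>d < 1\<close> amounts to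
  \<open>k2 < \<tau> / 2 * k1\<close>. So the hypotheses on the gain are the Jury
  conditions.\<close>

lemma agent_A_eigenvalue_bound:
  assumes k: "k \<in> carrier_mat 1 2" and \<tau>: "\<tau> > 0"
    and gains: "k $$ (0, 0) < 0" "\<tau> * k $$ (0, 1) > -2" "k $$ (0, 1) < \<tau> / 2 * k $$ (0, 0)"
    and ev: "eigenvalue (map_mat complex_of_real (agent_A \<tau> k)) l"
  shows "norm l < 1"
proof (rule quadratic_root_in_disc)
  let ?k1 = "k $$ (0, 0)" and ?k2 = "k $$ (0, 1)"
  let ?t = "2 + \<tau>\<^sup>2 / 2 * ?k1 + \<tau> * ?k2" and ?d = "1 - \<tau>\<^sup>2 / 2 * ?k1 + \<tau> * ?k2"
  have A: "agent_A \<tau> k \<in> carrier_mat 2 2" using agent_A_carrier[of \<tau> k] k by auto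
  have "agent_A \<tau> k $$ (0,0) + agent_A \<tau> k $$ (1,1) = ?t"
    and "agent_A \<tau> k $$ (0,0) * agent_A \<tau> k $$ (1,1)
      - agent_A \<tau> k $$ (0,1) * agent_A \<tau> k $$ (1,0) = ?d"
    using k by (simp_all add: agent_A_index power2_eq_square field_simps)
  then show "l\<^sup>2 - of_real ?t * l + of_real ?d = 0"
    using eigenvalue_2x2[OF _ ev] A by (simp flip: of_real_add of_real_mult of_real_diff)
  have "\<tau> * ?k2 < \<tau> * (\<tau> / 2 * ?k1)" using gains(3) \<tau> by simp
  then show "?d < 1" by (simp add: power2_eq_square)
  have "\<tau>\<^sup>2 * ?k1 < 0" using gains(1) \<tau> by (simp add: mult_pos_neg)
  then show "\<bar>?t\<bar> < 1 + ?d" using gains(2) by (simp add: abs_less_iff)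
qed

section \<open>The limit problem, with the gain of horizon 2\<close>

lemma sum_two_stages:
  fixes f :: "nat \<Rightarrow> 'a :: comm_monoid_add"
  assumes "p \<ge> 2" "k \<ge> 1" and "\<And>s. s \<in> {3..p} \<Longrightarrow> f s = 0"
  shows "sum f {k..p} = (if k \<le> 1 then f 1 else 0) + (if k \<le> 2 then f 2 else 0)"
proof -
  have "sum f {k..p} = sum f ({k..p} \<inter> {1, 2})"
  proof (intro sum.mono_neutral_right ballI)
    fix s assume "s \<in> {k..p} - {k..p} \<inter> {1, 2}"
    then have "s \<in> {3..p}" using assms(2) by auto
    then show "f s = 0" by (rule assms(3))
  qed auto
  also have "{k..p} \<inter> {1, 2} = (if k \<le> 1 then {1, 2} else if k \<le> 2 then {2} else {})"
    using assms by auto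
  finally show ?thesis by auto
qed

lemma sum_two_entries:
  fixes f :: "nat \<Rightarrow> 'a :: comm_monoid_add"
  assumes "p \<ge> 2" and "\<And>r. 2 \<le> r \<Longrightarrow> r < p \<Longrightarrow> f r = 0"
  shows "sum f {..<p} = f 0 + f 1"
proof -
  have "sum f {..<p} = sum f {0, 1}"
    using assms by (intro sum.mono_neutral_right) auto
  then show ?thesis by simp
qed

text \<open>With no weights \<open>\<alpha>\<close>, \<open>\<beta>\<close> beyond stage 2 the matrix
  \<open>H\<close> is diagonal in those stages, so the gain is the one of the horizon 2.\<close>

lemma agent_limit:
  fixes a b z :: "nat \<Rightarrow> real"
  assumes p: "p \<ge> 2" and \<tau>: "\<tau> > 0"
    and tail: "\<And>s. s \<in> {3..p} \<Longrightarrow> a s = 0 \<and> b s = 0 \<and> z s > 0"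
    and pos: "a 1 > 0" "b 1 > 0" "z 1 > 0" "a 2 \<ge> 0" "b 2 \<ge> 0" "z 2 \<ge> 0"
      "(a 2, b 2, z 2) \<noteq> (0, 0, 0)"
  defines "H \<equiv> agent_H p \<tau> a b z" and "K \<equiv> agent_K p \<tau> a b z"
  shows "det H \<noteq> 0"
    and "K $$ (0, 0) < 0" "\<tau> * K $$ (0, 1) > -2" "K $$ (0, 1) < \<tau> / 2 * K $$ (0, 0)"
proof -
  \<comment> \<open>Scaling the position weights by \<open>\<tau>\<^sup>2\<close> turns the leading
    block of \<open>H\<close> into \<open>\<tau>\<^sup>2\<close> times the matrix of
    \<open>two_stage_gain_bounds\<close>, in which the time step no longer occurs.\<close>
  define a1 where "a1 = \<tau>\<^sup>2 * a 1"
  define a2 where "a2 = \<tau>\<^sup>2 * a 2"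
  define h00 where "h00 = a1 / 4 + b 1 + (9 / 4 * a2 + b 2) + z 1"
  define h01 where "h01 = 3 / 4 * a2 + b 2"
  define h11 where "h11 = a2 / 4 + b 2 + z 2"
  have a12: "a1 > 0" "a2 \<ge> 0" "a2 + b 2 + z 2 > 0"
    using pos \<tau> by (auto simp: a1_def a2_def add_nonneg_pos add_pos_nonneg
      add_nonneg_nonneg order.strict_iff_order add_nonneg_eq_0_iff)
  note bounds = two_stage_gain_bounds[OF h00_def h01_def h11_def a12(1) pos(2,3) a12(2)
      pos(5,6) a12(3)]
  have Hc: "H \<in> carrier_mat p p" by (simp add: H_def)
  have H: "H $$ (r, c) =
      (if max (r + 1) (c + 1) \<le> 1
       then \<tau> ^ 4 / 4 * odd_gap 1 (r + 1) * odd_gap 1 (c + 1) * a 1 + \<tau>\<^sup>2 * b 1 else 0)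
      + (if max (r + 1) (c + 1) \<le> 2
         then \<tau> ^ 4 / 4 * odd_gap 2 (r + 1) * odd_gap 2 (c + 1) * a 2 + \<tau>\<^sup>2 * b 2 else 0)
      + (if r = c then \<tau>\<^sup>2 * z (r + 1) else 0)" if "r < p" "c < p" for r c
    using that tail unfolding H_def agent_H_def index_mat(1)[OF that] prod.case
    by (subst sum_two_stages[OF p]) auto
  \<comment> \<open>Index 2 stands for stage 3: from there on only the control weight is left on the
    diagonal.\<close>
  have H_far: "H $$ (r, c) = (if r = c then \<tau>\<^sup>2 * z (r + 1) else 0)"
    if "r < p" "c < p" "2 \<le> r \<or> 2 \<le> c" for r c
    using H[OF that(1,2)] that(3) by auto
  have H_near: "H $$ (0, 0) = \<tau>\<^sup>2 * h00" "H $$ (0, 1) = \<tau>\<^sup>2 * h01" "H $$ (1, 0) = \<tau>\<^sup>2 * h01"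
    "H $$ (1, 1) = \<tau>\<^sup>2 * h11"
    using p by (simp_all add: H h00_def h01_def h11_def a1_def a2_def odd_gap_def
      numeral_2_eq_2[symmetric] field_simps power2_eq_square power4_eq_xxxx)
  have ne: "\<tau>\<^sup>2 * z (r + 1) \<noteq> 0" if "2 \<le> r" "r < p" for r
    using tail[of "r + 1"] that \<tau> by auto
  \<comment> \<open>A kernel vector vanishes at the indices from 2 on because those rows are
    diagonal with nonzero entries; its first two coordinates then solve a homogeneous system with
    positive determinant.\<close>
  show det: "det H \<noteq> 0"
  proof
    assume "det H = 0"
    then obtain v where v: "v \<in> carrier_vec p" "v \<noteq> 0\<^sub>v p" "H *\<^sub>v v = 0\<^sub>v p"
      using det_0_iff_vec_prod_zero_field[OF Hc] by blast
    have row: "(\<Sum>c<p. H $$ (r, c) * v $ c) = 0" if "r < p" for r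
      using arg_cong[OF v(3), of "\<lambda>w. w $ r"] Hc v(1) that
      by (simp add: scalar_prod_def atLeast0LessThan)
    have far: "v $ r = 0" if r: "2 \<le> r" "r < p" for r
    proof -
      have "(\<Sum>c<p. H $$ (r, c) * v $ c) = (\<Sum>c<p. if c = r then \<tau>\<^sup>2 * z (r + 1) * v $ r else 0)"
        using r by (intro sum.cong) (auto simp: H_far)
      then show ?thesis using row[of r] ne r by simp
    qed
    have "\<tau>\<^sup>2 * (h00 * v $ 0 + h01 * v $ 1) = 0" "\<tau>\<^sup>2 * (h01 * v $ 0 + h11 * v $ 1) = 0"
      using row[of 0] row[of 1] p by (simp_all add: sum_two_entries far H_near[simplified] algebra_simps)
    then have v01: "h00 * v $ 0 + h01 * v $ 1 = 0" "h01 * v $ 0 + h11 * v $ 1 = 0"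
      using \<tau> by simp_all
    have "(h00 * h11 - h01 * h01) * v $ 0 =
        h11 * (h00 * v $ 0 + h01 * v $ 1) - h01 * (h01 * v $ 0 + h11 * v $ 1)"
      and "(h00 * h11 - h01 * h01) * v $ 1 =
        h00 * (h01 * v $ 0 + h11 * v $ 1) - h01 * (h00 * v $ 0 + h01 * v $ 1)"
      by (simp_all add: algebra_simps)
    then have "(h00 * h11 - h01 * h01) * v $ 0 = 0" "(h00 * h11 - h01 * h01) * v $ 1 = 0"
      unfolding v01 by simp_all
    then have "v $ 0 = 0" "v $ 1 = 0" using bounds(1) by (metis mult_eq_0_iff less_irrefl)+
    with far have "v $ r = 0" if "r < p" for r
      using that by (cases "r = 0 \<or> r = 1") auto
    then show False using v(1,2) by auto
  qed
  \<comment> \<open>Only the first row of the inverse enters the gain. The columns of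
    \<open>inv_det H * H = 1\<close> beyond index 1 force its far entries to vanish.\<close>
  define x where "x r = inv_det H $$ (0, r)" for r
  have col: "(\<Sum>r<p. x r * H $$ (r, c)) = (if c = 0 then 1 else 0)" if "c < p" for c
    using arg_cong[OF inv_det(3)[OF Hc det], of "\<lambda>M. M $$ (0, c)"] Hc inv_det(1)[OF Hc] that
    by (auto simp: scalar_prod_def atLeast0LessThan x_def)
  have far: "x c = 0" if c: "2 \<le> c" "c < p" for c
  proof -
    have "(\<Sum>r<p. x r * H $$ (r, c)) = (\<Sum>r<p. if r = c then x c * (\<tau>\<^sup>2 * z (c + 1)) else 0)"
      using c by (intro sum.cong) (auto simp: H_far)
    then show ?thesis using col[of c] ne c by simp
  qed
  \<comment> \<open>The factor \<open>\<tau>\<^sup>2\<close> of the leading block is moved into the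
    unknowns, which leaves the normalised system with right-hand side \<open>(1, 0)\<close>.\<close>
  define y0 where "y0 = \<tau>\<^sup>2 * x 0"
  define y1 where "y1 = \<tau>\<^sup>2 * x 1"
  have y: "y0 * h00 + y1 * h01 = 1" "y0 * h01 + y1 * h11 = 0"
    using col[of 0] col[of 1] p
    by (simp_all add: sum_two_entries far H_near[simplified] y0_def y1_def algebra_simps)
  have K: "K $$ (0, j) = - (x 0 * agent_G p \<tau> a b $$ (0, j) + x 1 * agent_G p \<tau> a b $$ (1, j))"
    if "j < 2" for j
    unfolding K_def using p that
    by (subst agent_K_index) (auto simp: x_def[symmetric] H_def[symmetric] sum_two_entries far)
  have G_entry: "agent_G p \<tau> a b $$ (r, j) =
      (if j = 0 then \<tau>\<^sup>2 * ((if r + 1 \<le> 1 then odd_gap 1 (r + 1) / 2 * a 1 else 0)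
          + (if r + 1 \<le> 2 then odd_gap 2 (r + 1) / 2 * a 2 else 0))
       else \<tau> ^ 3 * ((if r + 1 \<le> 1 then real 1 * (odd_gap 1 (r + 1) / 2) * a 1 else 0)
          + (if r + 1 \<le> 2 then real 2 * (odd_gap 2 (r + 1) / 2) * a 2 else 0))
        + \<tau> * ((if r + 1 \<le> 1 then b 1 else 0) + (if r + 1 \<le> 2 then b 2 else 0)))"
    if "r < p" "j < 2" for r j
    unfolding agent_G_def index_mat(1)[OF that] prod.case using tail
    by (subst sum_two_stages[OF p], simp, simp)+ (rule refl)
  have G: "agent_G p \<tau> a b $$ (0, 0) = a1 / 2 + 3 / 2 * a2" "agent_G p \<tau> a b $$ (1, 0) = a2 / 2"
    "agent_G p \<tau> a b $$ (0, 1) = \<tau> * (a1 / 2 + 3 * a2 + b 1 + b 2)"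
    "agent_G p \<tau> a b $$ (1, 1) = \<tau> * (a2 + b 2)"
    using p by (simp_all add: G_entry a1_def a2_def odd_gap_def numeral_2_eq_2[symmetric] field_simps
      power2_eq_square power3_eq_cube)
  \<comment> \<open>The gain turns out to be \<open>- P / \<tau>\<^sup>2\<close> and
    \<open>- Q / \<tau>\<close>, so the three Jury conditions read \<open>P > 0\<close>,
    \<open>Q < 2\<close> and \<open>Q > P / 2\<close>.\<close>
  define P where "P = y0 * (a1 / 2 + 3 / 2 * a2) + y1 * (a2 / 2)"
  define Q where "Q = y0 * (a1 / 2 + 3 * a2 + b 1 + b 2) + y1 * (a2 + b 2)"
  have PQ: "P > 0" "Q < 2" "Q > P / 2"
    using bounds(2)[OF y] by (simp_all add: P_def Q_def)
  have "K $$ (0, 0) = - (x 0 * (a1 / 2 + 3 / 2 * a2) + x 1 * (a2 / 2))"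
    unfolding G(1,2)[symmetric] by (rule K) simp
  also have "\<dots> = - P / \<tau>\<^sup>2"
    using \<tau> by (simp add: P_def y0_def y1_def field_simps)
  finally have K1: "K $$ (0, 0) = - P / \<tau>\<^sup>2" .
  have "K $$ (0, 1) = - (x 0 * (\<tau> * (a1 / 2 + 3 * a2 + b 1 + b 2)) + x 1 * (\<tau> * (a2 + b 2)))"
    unfolding G(3,4)[symmetric] by (rule K) simp
  also have "\<dots> = - Q / \<tau>"
    using \<tau> by (simp add: Q_def y0_def y1_def field_simps power2_eq_square)
  finally have K2: "K $$ (0, 1) = - Q / \<tau>" .
  show "K $$ (0, 0) < 0" "\<tau> * K $$ (0, 1) > -2" "K $$ (0, 1) < \<tau> / 2 * K $$ (0, 0)"
    unfolding K1 K2 using PQ \<tau> by (simp_all add: field_simps power2_eq_square)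
qed

section \<open>Perturbation of the limit and a bound common to all agents\<close>

text \<open>The conditions of \<open>agent_limit\<close> are open, and determinant and gain depend
  continuously on the weights near the limit, so the conditions persist along any filter on which
  the weights converge.\<close>

lemma eventually_agent_stable:
  fixes a b :: "'x \<Rightarrow> nat \<Rightarrow> real" and a0 b0 z :: "nat \<Rightarrow> real"
  assumes p: "p \<ge> 2" and \<tau>: "\<tau> > 0"
    and lim: "\<And>s. s \<in> {1..p} \<Longrightarrow> ((\<lambda>x. a x s) \<longlongrightarrow> a0 s) F"
      "\<And>s. s \<in> {1..p} \<Longrightarrow> ((\<lambda>x. b x s) \<longlongrightarrow> b0 s) F"
    and tail: "\<And>s. s \<in> {3..p} \<Longrightarrow> a0 s = 0 \<and> b0 s = 0 \<and> z s > 0"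
    and pos: "a0 1 > 0" "b0 1 > 0" "z 1 > 0" "a0 2 \<ge> 0" "b0 2 \<ge> 0" "z 2 \<ge> 0"
      "(a0 2, b0 2, z 2) \<noteq> (0, 0, 0)"
  shows "\<forall>\<^sub>F x in F. det (agent_H p \<tau> (a x) (b x) z) \<noteq> 0 \<and>
    (\<forall>l. eigenvalue (map_mat complex_of_real (agent_A \<tau> (agent_K p \<tau> (a x) (b x) z))) l
      \<longrightarrow> norm l < 1)"
proof -
  let ?H = "\<lambda>x. agent_H p \<tau> (a x) (b x) z" and ?HL = "agent_H p \<tau> a0 b0 z"
  let ?K = "\<lambda>x. agent_K p \<tau> (a x) (b x) z" and ?KL = "agent_K p \<tau> a0 b0 z"
  note limit = agent_limit[where a = a0 and b = b0 and z = z, OF p \<tau> tail pos]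
  have H_lim: "((\<lambda>x. ?H x $$ (r, c)) \<longlongrightarrow> ?HL $$ (r, c)) F" if "r < p" "c < p" for r c
    using that unfolding agent_H_def
    by (auto intro!: tendsto_intros lim)
  have det_lim: "((\<lambda>x. det (?H x)) \<longlongrightarrow> det ?HL) F"
    by (rule tendsto_det[where n = p]) (auto intro: H_lim)
  have X_lim: "((\<lambda>x. inv_det (?H x) $$ (0, r)) \<longlongrightarrow> inv_det ?HL $$ (0, r)) F" if "r < p" for r
  proof -
    \<comment> \<open>The adjugate transposes the cofactors, so row 0 of the inverse uses cofactors
      of column 0. The quotient converges because the limit determinant is nonzero.\<close>
    have "inv_det A $$ (0, r) = 1 / det A * cofactor A r 0" if "A \<in> carrier_mat p p" for A
      using that p \<open>r < p\<close> by (auto simp: inv_det_def adj_mat_def)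
    then show ?thesis
      using limit(1) that p
      by (auto intro!: tendsto_intros det_lim tendsto_cofactor[where n = p] H_lim)
  qed
  have G_lim: "((\<lambda>x. agent_G p \<tau> (a x) (b x) $$ (r, j)) \<longlongrightarrow> agent_G p \<tau> a0 b0 $$ (r, j)) F"
    if "r < p" "j < 2" for r j
    using that unfolding agent_G_def
    by (auto intro!: tendsto_intros lim)
  have K_lim: "((\<lambda>x. ?K x $$ (0, j)) \<longlongrightarrow> ?KL $$ (0, j)) F" if "j < 2" for j
    using p that by (simp add: agent_K_index)
      (auto intro!: tendsto_minus tendsto_sum tendsto_mult X_lim G_lim)
  have "\<forall>\<^sub>F x in F. det (?H x) \<noteq> 0"
    by (rule tendsto_imp_eventually_ne[OF det_lim limit(1)])
  moreover have "\<forall>\<^sub>F x in F. ?K x $$ (0, 0) < 0"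
    by (rule order_tendstoD(2)[OF K_lim limit(2)]) simp
  moreover have "\<forall>\<^sub>F x in F. \<tau> * ?K x $$ (0, 1) > -2"
    by (rule order_tendstoD(1)[OF tendsto_mult[OF tendsto_const K_lim] limit(3)]) simp
  \<comment> \<open>Both sides of this condition vary, so it is stated as a difference compared with
    the constant 0.\<close>
  moreover have "\<forall>\<^sub>F x in F. ?K x $$ (0, 1) - \<tau> / 2 * ?K x $$ (0, 0) < 0"
    by (rule order_tendstoD(2)[OF tendsto_diff[OF K_lim tendsto_mult[OF tendsto_const K_lim]]])
      (use limit(4) in auto)
  ultimately show ?thesis
    by eventually_elim (auto intro: agent_A_eigenvalue_bound[OF agent_K_carrier \<tau>])
qed

text \<open>\<open>\<alpha>0\<close> and \<open>\<beta>0\<close> supply the weights of stages 1 and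
  2, so that the bound is chosen before the later weights. Invertibility of \<open>H_mat\<close> is
  asserted as well, since otherwise \<open>A_c\<close> would rest on an unspecified inverse.\<close>

theorem proposition5p2:
  fixes p n :: nat and \<tau> :: real and \<alpha>0 \<beta>0 \<zeta> :: "nat \<Rightarrow> nat \<Rightarrow> real"
  assumes "p \<ge> 3" and "n \<ge> 1" and "\<tau> > 0"
    and "\<And>i. i \<in> {1..n} \<Longrightarrow> \<alpha>0 1 i > 0 \<and> \<beta>0 1 i > 0 \<and> \<zeta> 1 i > 0"
    and "\<And>i. i \<in> {1..n} \<Longrightarrow> \<alpha>0 2 i \<ge> 0 \<and> \<beta>0 2 i \<ge> 0 \<and> \<zeta> 2 i \<ge> 0"
    and "\<And>i. i \<in> {1..n} \<Longrightarrow> (\<alpha>0 2 i, \<beta>0 2 i, \<zeta> 2 i) \<noteq> (0, 0, 0)"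
    and "\<And>s i. s \<in> {3..p} \<Longrightarrow> i \<in> {1..n} \<Longrightarrow> \<zeta> s i > 0"
  shows "\<exists>\<epsilon> > 0. \<forall>\<alpha> \<beta> :: nat \<Rightarrow> nat \<Rightarrow> real.
      (\<forall>s\<in>{1, 2}. \<forall>i\<in>{1..n}. \<alpha> s i = \<alpha>0 s i \<and> \<beta> s i = \<beta>0 s i) \<longrightarrow>
      (\<forall>s\<in>{3..p}. \<forall>i\<in>{1..n}. \<alpha> s i \<in> {0..<\<epsilon>} \<and> \<beta> s i \<in> {0..<\<epsilon>}) \<longrightarrow>
      invertible_mat (H_mat p n \<tau> \<alpha> \<beta> \<zeta>) \<and> schur_stable (A_c p n \<alpha> \<beta> \<zeta> \<tau>)"
proof -
  define box :: "real \<Rightarrow> ((nat \<Rightarrow> nat \<Rightarrow> real) \<times> (nat \<Rightarrow> nat \<Rightarrow> real)) set" where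
    "box \<epsilon> = {(\<alpha>, \<beta>). (\<forall>s\<in>{1, 2}. \<forall>i\<in>{1..n}. \<alpha> s i = \<alpha>0 s i \<and> \<beta> s i = \<beta>0 s i) \<and>
      (\<forall>s\<in>{3..p}. \<forall>i\<in>{1..n}. \<alpha> s i \<in> {0..<\<epsilon>} \<and> \<beta> s i \<in> {0..<\<epsilon>})}" for \<epsilon>
  \<comment> \<open>The filter of weight families whose later stages shrink to zero. A property
    holds eventually along it exactly when one bound works for the whole box, which is the
    uniformity asked for.\<close>
  define F where "F = (INF \<epsilon>\<in>{0<..}. principal (box \<epsilon>))"
  have F: "eventually P F \<longleftrightarrow> (\<exists>\<epsilon>>0. \<forall>x\<in>box \<epsilon>. P x)" for P
  proof -
    \<comment> \<open>The boxes are nested, so they form a base of the filter.\<close>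
    have "\<exists>\<gamma>\<in>{0<..}. principal (box \<gamma>) \<le> inf (principal (box \<delta>)) (principal (box \<epsilon>))"
      if "\<delta> \<in> {0<..}" "\<epsilon> \<in> {0<..}" for \<delta> \<epsilon>
      using that by (intro bexI[of _ "min \<delta> \<epsilon>"]) (auto simp: box_def)
    then show ?thesis
      unfolding F_def by (subst eventually_INF_base) (auto simp: eventually_principal)
  qed
  have lim: "((\<lambda>x. fst x s i) \<longlongrightarrow> (if s \<le> 2 then \<alpha>0 s i else 0)) F"
    "((\<lambda>x. snd x s i) \<longlongrightarrow> (if s \<le> 2 then \<beta>0 s i else 0)) F"
    if "s \<in> {1..p}" "i \<in> {1..n}" for s i
  proof -
    have "s \<in> {1, 2} \<or> s \<in> {3..p}" using that by auto
    then show "((\<lambda>x. fst x s i) \<longlongrightarrow> (if s \<le> 2 then \<alpha>0 s i else 0)) F"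
      "((\<lambda>x. snd x s i) \<longlongrightarrow> (if s \<le> 2 then \<beta>0 s i else 0)) F"
      using that unfolding tendsto_iff F
      by (auto simp: box_def dist_real_def intro!: exI[of _ "e" for e])
  qed
  have "\<forall>\<^sub>F x in F. \<forall>i<n.
      det (agent_H p \<tau> (\<lambda>s. fst x s (i + 1)) (\<lambda>s. snd x s (i + 1)) (\<lambda>s. \<zeta> s (i + 1))) \<noteq> 0 \<and>
      (\<forall>l. eigenvalue (map_mat complex_of_real (agent_A \<tau>
        (agent_K p \<tau> (\<lambda>s. fst x s (i + 1)) (\<lambda>s. snd x s (i + 1)) (\<lambda>s. \<zeta> s (i + 1))))) l
        \<longrightarrow> norm l < 1)"
    (is "\<forall>\<^sub>F x in F. \<forall>i<n. ?stable x i")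
  proof -
    have "\<forall>\<^sub>F x in F. ?stable x i" if "i < n" for i
    proof (rule eventually_agent_stable[OF _ assms(3)])
      show "((\<lambda>x. fst x s (i + 1)) \<longlongrightarrow> (if s \<le> 2 then \<alpha>0 s (i + 1) else 0)) F"
        "((\<lambda>x. snd x s (i + 1)) \<longlongrightarrow> (if s \<le> 2 then \<beta>0 s (i + 1) else 0)) F"
        if "s \<in> {1..p}" for s
        using lim[of s "i + 1"] that \<open>i < n\<close> by auto
    qed (use assms(1) assms(4-6)[of "i + 1"] assms(7)[of _ "i + 1"] \<open>i < n\<close> in auto)
    \<comment> \<open>Finiteness of the set of agents yields one bound for all of them.\<close>
    then have "\<forall>\<^sub>F x in F. \<forall>i\<in>{..<n}. ?stable x i"
      by (intro eventually_ball_finite) auto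
    then show ?thesis by (simp only: Ball_def lessThan_iff)
  qed
  then obtain \<epsilon> where \<epsilon>: "\<epsilon> > 0" "\<And>x i. x \<in> box \<epsilon> \<Longrightarrow> i < n \<Longrightarrow> ?stable x i"
    unfolding F by blast
  show ?thesis
  proof (intro exI[of _ \<epsilon>] conjI allI impI \<epsilon>(1))
    fix \<alpha> \<beta> :: "nat \<Rightarrow> nat \<Rightarrow> real"
    assume "\<forall>s\<in>{1, 2}. \<forall>i\<in>{1..n}. \<alpha> s i = \<alpha>0 s i \<and> \<beta> s i = \<beta>0 s i"
      and "\<forall>s\<in>{3..p}. \<forall>i\<in>{1..n}. \<alpha> s i \<in> {0..<\<epsilon>} \<and> \<beta> s i \<in> {0..<\<epsilon>}"
    then have "(\<alpha>, \<beta>) \<in> box \<epsilon>" unfolding box_def by blast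
    note stable = \<epsilon>(2)[OF this, unfolded fst_conv snd_conv]
    show "invertible_mat (H_mat p n \<tau> \<alpha> \<beta> \<zeta>)"
      using stable by (intro closed_loop_agents(1)) blast
    define k where "k i = agent_K p \<tau> (\<lambda>s. \<alpha> s (i + 1)) (\<lambda>s. \<beta> s (i + 1)) (\<lambda>s. \<zeta> s (i + 1))" for i
    have Ac: "agent_A \<tau> (k i) \<in> carrier_mat 2 2" for i
      using agent_A_carrier[of \<tau> "k i"] carrier_matD(2)[OF agent_K_carrier] by (simp add: k_def)
    have "A_c p n \<alpha> \<beta> \<zeta> \<tau> = agent_mat n 2 2 (\<lambda>i. agent_A \<tau> (k i))"
      unfolding k_def using stable by (intro closed_loop_agents(2)) blast
    then have A: "map_mat complex_of_real (A_c p n \<alpha> \<beta> \<zeta> \<tau>) =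
        agent_mat n 2 2 (\<lambda>i. map_mat complex_of_real (agent_A \<tau> (k i)))"
      using agent_mat_map[OF Ac, of complex_of_real] by simp
    \<comment> \<open>The spectral radius is attained at an eigenvalue because the dimension
      \<open>2 * n\<close> is positive; that eigenvalue belongs to some agent.\<close>
    obtain l where l: "eigenvalue (map_mat complex_of_real (A_c p n \<alpha> \<beta> \<zeta> \<tau>)) l"
        "spectral_radius (map_mat complex_of_real (A_c p n \<alpha> \<beta> \<zeta> \<tau>)) = norm l"
      using spectral_radius_mem_max(1)[of "map_mat complex_of_real (A_c p n \<alpha> \<beta> \<zeta> \<tau>)" "2 * n"] assms(2)
      unfolding A spectrum_def by auto
    obtain i where "i < n" "eigenvalue (map_mat complex_of_real (agent_A \<tau> (k i))) l"
      using eigenvalue_agent_mat[of n "\<lambda>i. map_mat complex_of_real (agent_A \<tau> (k i))" 2 l]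
        l(1) Ac unfolding A by auto
    then show "schur_stable (A_c p n \<alpha> \<beta> \<zeta> \<tau>)"
      using stable[of i] unfolding schur_stable_def l(2) k_def by blast
  qed
qed

end
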